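(* If $a>0$ and $b>0$ are integers, then there exists a unique integer $c\ge 0$ such that the Twyst-off position $(a,b,c)$ is a $P$ position. Furthermore, this $c$ satisfies $c\le a+b+\min\{a,b\}+1$.
   Context: Twyst-off is a two-player impartial game (players alternate; normal play: the last player to move legally wins). A position is a finite ordered sequence $(s_1,\dots,s_n)$ of stacks of tiles, with stack sizes nonnegative integers. Positions are subject to the identifications: an end stack of size $0$ is deleted (so $(a,b,0)=(a,b)$); an interior stack of size $0$ is deleted and its two neighbors are combined, i.e. $(\dots,x,0,y,\dots)=(\dots,x+y,\dots)$. Thus every position equals a (possibly empty) sequence of positive integers. From a sequence of positive integers, a move is one of: (i) remove $k\ge 1$ tiles from the first or from the last stack; (ii) remove the same number $k\ge 1$ of tiles from two consecutive stacks; after which the identifications are applied. A position is $P$ if the previous (second) player can force a win, equivalently if none of its options (positions reachable in one move) is $P$; it is $N$ if the next (first) player can force a win, equivalently if some option is $P$. *)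

theory Defs
  imports Main
begin

inductive identify :: "nat list \<Rightarrow> nat list \<Rightarrow> bool" where
  leading: "identify (0 # xs) xs"
| trailing: "identify (xs @ [0]) xs"
| interior: "identify (xs @ x # 0 # y # ys) (xs @ (x + y) # ys)"

text \<open>
  Each class of sequences under \<^const>\<open>identify\<close> has exactly one member without empty
  stacks; \<open>reduce\<close> computes it. That it does so is the content of the lemmas
  \<open>reduce_positive\<close>, \<open>identify_reduce\<close> and \<open>identify_imp_reduce_eq\<close>.
\<close>

fun reduce :: "nat list \<Rightarrow> nat list" where
  "reduce [] = []"
| "reduce (0 # xs) = reduce xs"
| "reduce [Suc x] = [Suc x]"
| "reduce [Suc x, 0] = [Suc x]"
| "reduce (Suc x # 0 # y # ys) = reduce ((Suc x + y) # ys)"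
| "reduce (Suc x # Suc y # ys) = Suc x # reduce (Suc y # ys)"

inductive removal :: "nat list \<Rightarrow> nat list \<Rightarrow> bool" where
  first_stack: "1 \<le> k \<Longrightarrow> k \<le> x \<Longrightarrow> removal (x # xs) ((x - k) # xs)"
| last_stack: "1 \<le> k \<Longrightarrow> k \<le> x \<Longrightarrow> removal (xs @ [x]) (xs @ [x - k])"
| adjacent_stacks: "1 \<le> k \<Longrightarrow> k \<le> x \<Longrightarrow> k \<le> y \<Longrightarrow>
    removal (xs @ x # y # ys) (xs @ (x - k) # (y - k) # ys)"

text \<open>
  Moves are made from sequences of positive integers only, hence the inner \<^const>\<open>reduce\<close>;
  in particular identified sequences have the same options.
\<close>

definition twyst_option :: "nat list \<Rightarrow> nat list \<Rightarrow> bool" where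
  "twyst_option p q \<longleftrightarrow> (\<exists>r. removal (reduce p) r \<and> q = reduce r)"

text \<open>
  The least fixed point says that the player in question can force a win in finitely many
  moves. The recursive characterisation is \<open>P_position_iff\<close> below.
\<close>

inductive P_position :: "nat list \<Rightarrow> bool" and N_position :: "nat list \<Rightarrow> bool" where
  P: "(\<And>q. twyst_option p q \<Longrightarrow> N_position q) \<Longrightarrow> P_position p"
| N: "twyst_option p q \<Longrightarrow> P_position q \<Longrightarrow> N_position p"

lemma reduce_positive: "0 \<notin> set (reduce p)"
  by (induction p rule: reduce.induct) auto

lemma identify_Cons:
  assumes "identify p q" and "p \<noteq> []" and "hd p \<noteq> 0"
  shows "identify (x # p) (x # q)"
  using assms(1)
proof cases
  case leading
  then show ?thesis using assms by simp
next
  case trailing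
  then show ?thesis using identify.trailing[of "x # q"] by simp
next
  case (interior xs x' y ys)
  then show ?thesis using identify.interior[of "x # xs" x' y ys] by simp
qed

lemma identify_hd: "identify p q \<Longrightarrow> p \<noteq> [] \<Longrightarrow> hd p \<noteq> 0 \<Longrightarrow> q \<noteq> [] \<and> hd q \<noteq> 0"
  by (cases rule: identify.cases) (auto simp: hd_append split: if_splits)

lemma identify_rtranclp_Cons:
  "identify\<^sup>*\<^sup>* p q \<Longrightarrow> p \<noteq> [] \<Longrightarrow> hd p \<noteq> 0 \<Longrightarrow> identify\<^sup>*\<^sup>* (x # p) (x # q)"
proof (induction rule: converse_rtranclp_induct)
  case (step y z)
  have 1: "identify (x # y) (x # z)"
    using step by (simp add: identify_Cons)
  have 2: "identify\<^sup>*\<^sup>* (x # z) (x # q)"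
    using step identify_hd[of y z] by simp
  show ?case
    by (rule converse_rtranclp_into_rtranclp[of identify, OF 1 2])
qed simp

lemma identify_reduce: "identify\<^sup>*\<^sup>* p (reduce p)"
proof (induction p rule: reduce.induct)
  case (2 xs)
  have "identify\<^sup>*\<^sup>* (0 # xs) (reduce xs)"
    by (rule converse_rtranclp_into_rtranclp[of identify, OF identify.leading 2])
  then show ?case by simp
next
  case (4 x)
  then show ?case using identify.trailing[of "[Suc x]"] by auto
next
  case (5 x y ys)
  have "identify (Suc x # 0 # y # ys) ((Suc x + y) # ys)"
    using identify.interior[of "[]" "Suc x" y ys] by simp
  from converse_rtranclp_into_rtranclp[of identify, OF this 5] show ?case by simp
next
  case (6 x y ys)
  then show ?case using identify_rtranclp_Cons[of "Suc y # ys"] by simp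
qed simp_all

lemma reduce_back: "reduce (xs @ [0]) = reduce xs"
  by (induction xs rule: reduce.induct) auto

lemma reduce_merge: "reduce (xs @ x # 0 # y # ys) = reduce (xs @ (x + y) # ys)"
proof (induction xs rule: reduce.induct)
  case 1
  then show ?case by (cases x) auto
next
  case (3 x')
  then show ?case by (cases x; cases y) auto
next
  case (4 x')
  then show ?case by (cases "Suc x' + x") (auto simp: add.assoc)
qed (auto simp: add.assoc)

lemma identify_imp_reduce_eq: "identify p q \<Longrightarrow> reduce p = reduce q"
  by (induction rule: identify.induct) (auto simp: reduce_back reduce_merge)

lemma reduce_idem: "reduce (reduce p) = reduce p"
proof -
  have "identify\<^sup>*\<^sup>* p q \<Longrightarrow> reduce p = reduce q" for q
    by (induction rule: rtranclp_induct) (auto dest: identify_imp_reduce_eq)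
  then show ?thesis using identify_reduce by metis
qed

lemma sum_list_reduce: "sum_list (reduce p) = sum_list p"
  by (induction p rule: reduce.induct) auto

lemma sum_list_removal: "removal p q \<Longrightarrow> sum_list q < sum_list p"
  by (induction rule: removal.induct) auto

lemma sum_list_option: "twyst_option p q \<Longrightarrow> sum_list q < sum_list p"
  by (auto simp: twyst_option_def sum_list_reduce dest: sum_list_removal)

lemma N_position_iff_not_P: "N_position p \<longleftrightarrow> \<not> P_position p"
proof (induction "sum_list p" arbitrary: p rule: less_induct)
  case less
  have IH: "N_position q \<longleftrightarrow> \<not> P_position q" if "twyst_option p q" for q
    using less sum_list_option[OF that] by blast
  show ?case
    by (subst N_position.simps, subst P_position.simps) (use IH in blast)
qed

lemma P_position_iff: "P_position p \<longleftrightarrow> (\<forall>q. twyst_option p q \<longrightarrow> \<not> P_position q)"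
  by (subst P_position.simps) (simp add: N_position_iff_not_P)

lemma P_position_reduce: "P_position (reduce p) \<longleftrightarrow> P_position p"
  by (simp add: P_position_iff[of p] P_position_iff[of "reduce p"] twyst_option_def reduce_idem)

end

(* The last stack of a P position is determined by the others, since a larger last stack can be
   reduced to a smaller one. Hence if (a,b,c) is an N position for every c up to a bound, each c
   is excluded by a winning move that touches a or b; there are at most a + min a b + b such moves
   and each of them excludes at most one c. *)
theory Submission imports Defs begin

text \<open>Empty stacks at the end of \<open>xs\<close> can merge earlier tiles into the last
  stack; \<open>d\<close> counts those tiles. Since \<open>d\<close> and \<open>ys\<close> do not
  depend on \<open>c'\<close>, changing the last stack commutes with the identifications. The second
  equation keeps an outer \<open>reduce\<close> because \<open>d + c'\<close> may be
  \<open>0\<close>.\<close>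

lemma reduce_snoc:
  assumes "c > 0"
  obtains ys d where "reduce (xs @ [c]) = ys @ [d + c]"
    and "\<And>c'. reduce (xs @ [c']) = reduce (ys @ [d + c'])"
proof -
  have "\<exists>ys d. reduce (xs @ [c]) = ys @ [d + c] \<and>
      (\<forall>c'. reduce (xs @ [c']) = reduce (ys @ [d + c']))"
  proof (induction xs rule: reduce.induct)
    case 1
    from assms obtain m where "c = Suc m" by (cases c) auto
    then show ?case by (intro exI[of _ "[]"] exI[of _ 0]) simp
  next
    case (3 x)
    from assms obtain m where "c = Suc m" by (cases c) auto
    then show ?case by (intro exI[of _ "[Suc x]"] exI[of _ 0]) simp
  next
    case (4 x)
    then show ?case by (intro exI[of _ "[]"] exI[of _ "Suc x"]) simp
  next
    case (6 x y ys)
    then obtain zs d where zs: "reduce ((Suc y # ys) @ [c]) = zs @ [d + c]"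
      "\<And>c'. reduce ((Suc y # ys) @ [c']) = reduce (zs @ [d + c'])"
      by blast
    have "reduce (Suc x # reduce (Suc y # ys @ [c'])) = Suc x # reduce (Suc y # ys @ [c'])" for c'
      using reduce_idem[of "Suc x # Suc y # ys @ [c']"] by simp
    \<comment> \<open>A positive stack can be pulled out of \<open>reduce\<close> when the next
      stack is positive. For empty \<open>zs\<close> this follows from the preserved number of
      tiles, which is positive because of \<open>Suc y\<close>.\<close>
    moreover have "reduce (Suc x # zs @ [d + c']) = Suc x # reduce (zs @ [d + c'])" for c'
    proof (cases zs)
      case Nil
      then have "d + c' \<noteq> 0"
        using zs(2)[of c'] sum_list_reduce[of "Suc y # ys @ [c']"] sum_list_reduce[of "[d + c']"]
        by simp
      with Nil show ?thesis by (cases "d + c'") auto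
    next
      case (Cons z zs')
      then have "z \<noteq> 0"
        using zs(1) reduce_positive[of "(Suc y # ys) @ [c]"] by auto
      with Cons show ?thesis by (cases z) auto
    qed
    ultimately show ?case
      using zs by (intro exI[of _ "Suc x # zs"] exI[of _ d]) simp
  qed auto
  then show thesis using that by blast
qed

lemma twyst_option_snoc:
  assumes "c' < c"
  shows "twyst_option (xs @ [c]) (reduce (xs @ [c']))"
proof -
  from assms obtain ys d where *: "reduce (xs @ [c]) = ys @ [d + c]"
    "reduce (xs @ [c']) = reduce (ys @ [d + c'])"
    using reduce_snoc[of c xs] by (metis gr_implies_not0 neq0_conv)
  have "removal (ys @ [d + c]) (ys @ [d + c'])"
    using last_stack[of "c - c'" "d + c" ys] assms by simp
  with * show ?thesis unfolding twyst_option_def by metis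
qed

lemma P_position_snoc_unique:
  assumes "P_position (xs @ [c])" and "P_position (xs @ [c'])"
  shows "c = c'"
  using assms twyst_option_snoc P_position_iff P_position_reduce by (metis nat_neq_iff)

text \<open>No positivity is assumed, so that this also applies to triples whose first or second
  stack has been emptied by a move.\<close>

lemma P_position_triple_unique: "P_position [a, b, c] \<Longrightarrow> P_position [a, b, c'] \<Longrightarrow> c = c'"
  using P_position_snoc_unique[of "[a, b]"] by simp

lemma removal_triple:
  assumes "removal [a, b, c] r"
  shows "(\<exists>x<a. r = [x, b, c]) \<or> (\<exists>k\<in>{1..min a b}. r = [a - k, b - k, c]) \<or>
    (\<exists>k\<in>{1..b}. k \<le> c \<and> r = [a, b - k, c - k]) \<or> (\<exists>z<c. r = [a, b, z])"
  using assms
proof cases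
  case (first_stack k)
  then have "a - k < a \<and> r = [a - k, b, c]" by auto
  then show ?thesis by blast
next
  case (last_stack k x xs)
  then have "xs = [a, b]" "x = c" by (auto simp: Cons_eq_append_conv)
  with last_stack have "c - k < c \<and> r = [a, b, c - k]" by auto
  then show ?thesis by blast
next
  case (adjacent_stacks k x y xs ys)
  then show ?thesis by (auto simp: Cons_eq_append_conv)
qed

text \<open>Positive stacks make the triple its own reduced form, so its winning moves are exactly
  removals from these three stacks.\<close>

lemma N_position_tripleE:
  assumes "a > 0" "b > 0" "c > 0" and "\<not> P_position [a, b, c]"
  obtains x where "x < a" "P_position [x, b, c]"
  | k where "k \<in> {1..min a b}" "P_position [a - k, b - k, c]"
  | k where "k \<in> {1..b}" "k \<le> c" "P_position [a, b - k, c - k]"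
  | z where "z < c" "P_position [a, b, z]"
proof -
  have "reduce [a, b, c] = [a, b, c]"
    using assms(1-3) by (cases a; cases b; cases c) auto
  with assms(4) obtain r where "removal [a, b, c] r" "P_position r"
    using P_position_iff[of "[a, b, c]"] P_position_reduce by (auto simp: twyst_option_def)
  with removal_triple[of a b c r] that show thesis by blast
qed

text \<open>Every \<open>A i\<close> is empty or a singleton. This lets excluded values of
  \<open>c\<close> be counted by the moves that exclude them.\<close>

lemma card_UN_le_card:
  assumes "finite I" and "\<And>i x y. i \<in> I \<Longrightarrow> x \<in> A i \<Longrightarrow> y \<in> A i \<Longrightarrow> x = y"
  shows "finite (\<Union>i\<in>I. A i) \<and> card (\<Union>i\<in>I. A i) \<le> card I"
proof -
  have A: "finite (A i) \<and> card (A i) \<le> 1" if "i \<in> I" for i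
    using assms(2)[OF that] is_singletonI'[of "A i"]
    by (cases "A i = {}") (auto simp: is_singleton_def)
  have "card (\<Union>i\<in>I. A i) \<le> (\<Sum>i\<in>I. card (A i))"
    by (rule card_UN_le[OF assms(1)])
  also have "\<dots> \<le> (\<Sum>i\<in>I. 1)"
    by (rule sum_mono) (use A in blast)
  finally show ?thesis using A assms(1) by auto
qed

lemma P_position_triple_exists:
  assumes "a > 0" and "b > 0"
  shows "\<exists>c \<le> a + b + min a b + 1. P_position [a, b, c]"
proof (rule ccontr)
  let ?M = "a + b + min a b + 1"
  assume "\<not> ?thesis"
  then have N: "\<not> P_position [a, b, c]" if "c \<le> ?M" for c
    using that by blast
  define U where "U = (\<Union>x\<in>{..<a}. {c. P_position [x, b, c]})"
  define V where "V = (\<Union>k\<in>{1..min a b}. {c. P_position [a - k, b - k, c]})"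
  define W where "W = (\<Union>k\<in>{1..b}. {c. k \<le> c \<and> P_position [a, b - k, c - k]})"
  have U: "finite U \<and> card U \<le> card {..<a}"
    unfolding U_def by (rule card_UN_le_card) (auto dest: P_position_triple_unique)
  have V: "finite V \<and> card V \<le> card {1..min a b}"
    unfolding V_def by (rule card_UN_le_card) (auto dest: P_position_triple_unique)
  \<comment> \<open>For fixed \<open>k\<close>, uniqueness determines \<open>c - k\<close>; the
    condition \<open>k \<le> c\<close> rules out truncated subtraction, so \<open>c\<close> is
    determined as well.\<close>
  have W: "finite W \<and> card W \<le> card {1..b}"
    unfolding W_def
    by (rule card_UN_le_card) (auto dest: P_position_triple_unique intro: eq_diff_iff[THEN iffD1])
  \<comment> \<open>The value \<open>0\<close> is left out because the case analysis needs
    \<open>c > 0\<close>. The remaining \<open>?M\<close> values are still one more than the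
    \<open>a + min a b + b\<close> available moves.\<close>
  have "{1..?M} \<subseteq> U \<union> V \<union> W"
  proof
    fix c assume c: "c \<in> {1..?M}"
    then have "c > 0" "\<not> P_position [a, b, c]" using N by auto
    with assms show "c \<in> U \<union> V \<union> W"
    proof (cases rule: N_position_tripleE)
      \<comment> \<open>Shortening the last stack stays within the bound, where no P position exists
        by assumption.\<close>
      case (4 z)
      then show ?thesis using N[of z] c by simp
    qed (auto simp: U_def V_def W_def)
  qed
  then have "card {1..?M} \<le> card (U \<union> V \<union> W)"
    using U V W by (intro card_mono) auto
  also have "\<dots> \<le> card U + card V + card W"
    using card_Un_le[of "U \<union> V" W] card_Un_le[of U V] by linarith
  also have "\<dots> \<le> a + min a b + b"
    using U V W unfolding card_lessThan card_atLeastAtMost by linarith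
  finally show False by (simp only: card_atLeastAtMost)
qed

theorem theorem3:
  fixes a b :: nat
  assumes "a > 0" and "b > 0"
  shows "(\<exists>!c. P_position [a, b, c]) \<and>
    (\<forall>c. P_position [a, b, c] \<longrightarrow> c \<le> a + b + min a b + 1)"
  using P_position_triple_exists[OF assms] P_position_triple_unique by metis

end
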